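(* Let $m_0\ge 1$, let $N_1\in\mathbb{Z}$, and let $0\leq t_1<t_2<\dots<t_{m_0}<2\pi$. Then for every $1\le p\le m_0$ the interpolating functions $\phi_p$ and $\psi_p$ (defined in the context through the inverse of $\mathbf{H}$) have the closed forms $$\phi_p(t)=-\mathrm{i}\,e^{\mathrm{i}N_1(t-t_p)}\bigl(e^{\mathrm{i}(t-t_p)}-1\bigr)\prod_{\substack{s=1\\ s\ne p}}^{m_0}\bigl(e^{\mathrm{i}t}-e^{\mathrm{i}t_s}\bigr)^{2}\bigl(e^{\mathrm{i}t_s}-e^{\mathrm{i}t_p}\bigr)^{-2}$$ and $$\begin{aligned}\psi_p(t)={}&2e^{\mathrm{i}N_1(t-t_p)}\bigl(e^{\mathrm{i}t}-e^{\mathrm{i}t_p}\bigr)\Biggl[\prod_{\substack{s=1\\ s\ne p}}^{m_0}\bigl(e^{\mathrm{i}t}-e^{\mathrm{i}t_s}\bigr)^{2}\bigl(e^{\mathrm{i}t_s}-e^{\mathrm{i}t_p}\bigr)^{-3}\Biggr]\sum_{\substack{s=1\\ s\neq p}}^{m_0}\ \prod_{\substack{1\le q\le m_0\\ q\ne p,\,q\ne s}}\bigl(e^{\mathrm{i}t_q}-e^{\mathrm{i}t_p}\bigr)\\&-\mathrm{i}N_1\phi_p(t)+e^{\mathrm{i}N_1(t-t_p)}\prod_{\substack{s=1\\ s\ne p}}^{m_0}\bigl(e^{\mathrm{i}t}-e^{\mathrm{i}t_s}\bigr)^{2}\bigl(e^{\mathrm{i}t_s}-e^{\mathrm{i}t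_p}\bigr)^{-2}.\end{aligned}$$
   Context: Here $\mathrm{i}$ is the imaginary unit; empty products equal $1$ and empty sums equal $0$. Given the points $t_1,\dots,t_{m_0}$ and $N_1\in\mathbb{Z}$, let $\mathbf{H}=[v_{kj}]_{1\le k,j\le 2m_0}$ be the square matrix with entries $$v_{kj}=\begin{cases} e^{\mathrm{i}(N_1+k-1)t_p}, & j=2p-1,\\ \mathrm{i}(N_1+k-1)e^{\mathrm{i}(N_1+k-1)t_p}, & j=2p,\end{cases}\qquad 1\le p\le m_0 .$$ The matrix $\mathbf{H}$ is invertible (the points being distinct in $[0,2\pi)$). Let $w_j(k)$ denote the $(j,k)$ element of $\mathbf{H}^{-1}$. The interpolating functions are $$\phi_p(t)=\sum_{k=1}^{2m_0}w_{2p}(k)\,e^{\mathrm{i}(N_1+k-1)t},\qquad \psi_p(t)=\sum_{k=1}^{2m_0}w_{2p-1}(k)\,e^{\mathrm{i}(N_1+k-1)t},\qquad 1\le p\le m_0 .$$ *)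

theory Defs
  imports Complex_Main "Jordan_Normal_Form.Gauss_Jordan_Elimination"
begin

text \<open>All indices in \<open>node_entry\<close>, \<open>inv_entry\<close>, \<open>phi\<close> and \<open>psi\<close> start at 1, as do the
  points \<open>t 1, \<dots>, t m0\<close>; the library matrices are indexed from 0, so the shift by one
  takes place in \<open>node_matrix\<close> and \<open>inv_entry\<close>.\<close>

definition node_entry :: "int \<Rightarrow> (nat \<Rightarrow> real) \<Rightarrow> nat \<Rightarrow> nat \<Rightarrow> complex" where
  "node_entry N1 t k j =
     (if odd j
      then exp (\<i> * of_int (N1 + int k - 1) * of_real (t ((j + 1) div 2)))
      else \<i> * of_int (N1 + int k - 1) * exp (\<i> * of_int (N1 + int k - 1) * of_real (t (j div 2))))"

definition node_matrix :: "nat \<Rightarrow> int \<Rightarrow> (nat \<Rightarrow> real) \<Rightarrow> complex mat" where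
  "node_matrix m0 N1 t =
     mat (2 * m0) (2 * m0) (\<lambda>(k, j). node_entry N1 t (k + 1) (j + 1))"

text \<open>\<open>mat_inverse\<close> of a square matrix is \<open>None\<close> iff the matrix is singular, in which case
  \<open>inv_entry\<close> is unspecified; for distinct points in \<open>[0, 2 \<pi>)\<close> this does not occur.\<close>

definition inv_entry :: "nat \<Rightarrow> int \<Rightarrow> (nat \<Rightarrow> real) \<Rightarrow> nat \<Rightarrow> nat \<Rightarrow> complex" where
  "inv_entry m0 N1 t j k = the (mat_inverse (node_matrix m0 N1 t)) $$ (j - 1, k - 1)"

definition phi :: "nat \<Rightarrow> int \<Rightarrow> (nat \<Rightarrow> real) \<Rightarrow> nat \<Rightarrow> real \<Rightarrow> complex" where
  "phi m0 N1 t p x =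
     (\<Sum>k = 1..2 * m0. inv_entry m0 N1 t (2 * p) k * exp (\<i> * of_int (N1 + int k - 1) * of_real x))"

definition psi :: "nat \<Rightarrow> int \<Rightarrow> (nat \<Rightarrow> real) \<Rightarrow> nat \<Rightarrow> real \<Rightarrow> complex" where
  "psi m0 N1 t p x =
     (\<Sum>k = 1..2 * m0. inv_entry m0 N1 t (2 * p - 1) k * exp (\<i> * of_int (N1 + int k - 1) * of_real x))"

end

(* Writing z = e^{it}, each interpolating function is e^{i N_1 t} times a polynomial in z of
   degree less than 2 m_0, and the equation H^{-1} H = 1 says that the value and the derivative
   of this function at the nodes form a Kronecker delta.  So phi_p and psi_p solve a Hermite
   interpolation problem at the distinct nodes e^{i t_s}, whose solution is explicit in terms of
   the Lagrange basis polynomials l_p: with a = e^{i t_p}, the polynomial (z - a) l_p^2 has a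
   prescribed derivative and l_p^2 - 2 l_p'(a) (z - a) l_p^2 a prescribed value.  Exhibiting these
   solutions also yields a left inverse of H, hence its invertibility. *)

theory Submission
  imports Defs "Jordan_Normal_Form.Determinant" "HOL-Computational_Algebra.Polynomial"
begin

section \<open>Hermite interpolation\<close>

definition lagrange_basis :: "'i set \<Rightarrow> ('i \<Rightarrow> 'a::field) \<Rightarrow> 'i \<Rightarrow> 'a poly" where
  "lagrange_basis I z p = (\<Prod>s\<in>I - {p}. smult (inverse (z p - z s)) [:- z s, 1:])"

definition hermite_slope :: "'i set \<Rightarrow> ('i \<Rightarrow> 'a::field) \<Rightarrow> 'i \<Rightarrow> 'a poly" where
  "hermite_slope I z p = [:- z p, 1:] * (lagrange_basis I z p)\<^sup>2"

text \<open>The square of the basis polynomial already has the right values, but its derivative at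
  \<open>z p\<close> is twice that of the basis polynomial. The slope polynomial vanishes at every
  node, so subtracting a multiple of it repairs the derivative without touching the values.\<close>

definition hermite_value :: "'i set \<Rightarrow> ('i \<Rightarrow> 'a::field) \<Rightarrow> 'i \<Rightarrow> 'a poly" where
  "hermite_value I z p = (lagrange_basis I z p)\<^sup>2
     - smult (2 * poly (pderiv (lagrange_basis I z p)) (z p)) (hermite_slope I z p)"

lemma poly_lagrange_basis:
  "poly (lagrange_basis I z p) x = (\<Prod>s\<in>I - {p}. (x - z s) / (z p - z s))"
  by (auto simp: lagrange_basis_def poly_prod divide_inverse algebra_simps intro!: prod.cong)

lemma poly_lagrange_basis_node:
  assumes "finite I" "inj_on z I" "p \<in> I" "s \<in> I"
  shows "poly (lagrange_basis I z p) (z s) = (if s = p then 1 else 0)"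
proof (cases "s = p")
  case True
  have "(z p - z q) / (z p - z q) = 1" if "q \<in> I - {p}" for q
    using that assms by (auto simp: inj_on_def)
  then show ?thesis
    using True by (simp add: poly_lagrange_basis)
next
  case False
  then show ?thesis
    using assms by (auto simp: poly_lagrange_basis intro!: prod_zero)
qed

text \<open>Product rule: each factor is normalised to equal 1 at \<open>z p\<close>, so only the
  slope of the differentiated factor survives in each summand.\<close>

lemma poly_pderiv_lagrange_basis:
  assumes "finite I" "inj_on z I" "p \<in> I"
  shows "poly (pderiv (lagrange_basis I z p)) (z p) = (\<Sum>s\<in>I - {p}. inverse (z p - z s))"
proof -
  have "poly (\<Prod>q\<in>I - {p} - {s}. smult (inverse (z p - z q)) [:- z q, 1:]) (z p) = 1" for s
    unfolding poly_prod
  proof (rule prod.neutral, rule ballI)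
    fix q assume "q \<in> I - {p} - {s}"
    then have "z p - z q \<noteq> 0"
      using assms by (auto simp: inj_on_def)
    then show "poly (smult (inverse (z p - z q)) [:- z q, 1:]) (z p) = 1"
      using left_inverse[of "z p - z q"] by (simp add: algebra_simps)
  qed
  then show ?thesis
    by (simp add: lagrange_basis_def pderiv_prod poly_sum pderiv_smult pderiv_pCons)
qed

lemma degree_lagrange_basis:
  assumes "finite I" "p \<in> I"
  shows "degree (lagrange_basis I z p) < card I"
proof -
  have "degree (lagrange_basis I z p)
      \<le> sum (degree \<circ> (\<lambda>s. smult (inverse (z p - z s)) [:- z s, 1:])) (I - {p})"
    unfolding lagrange_basis_def using assms by (intro degree_prod_sum_le) auto
  also have "\<dots> \<le> sum (\<lambda>_. 1) (I - {p})"
    by (intro sum_mono) auto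
  also have "\<dots> < card I"
    using assms card_gt_0_iff[of I] by auto
  finally show ?thesis .
qed

lemma degree_hermite_slope:
  assumes "finite I" "p \<in> I"
  shows "degree (hermite_slope I z p) < 2 * card I"
proof -
  have "degree (hermite_slope I z p) \<le> 1 + degree ((lagrange_basis I z p)\<^sup>2)"
    unfolding hermite_slope_def by (rule order_trans[OF degree_mult_le]) simp
  also have "degree ((lagrange_basis I z p)\<^sup>2) \<le> degree (lagrange_basis I z p) * 2"
    by (rule degree_power_le)
  finally show ?thesis
    using degree_lagrange_basis[OF assms, of z] by linarith
qed

lemma degree_hermite_value:
  assumes "finite I" "p \<in> I"
  shows "degree (hermite_value I z p) < 2 * card I"
proof -
  have "degree ((lagrange_basis I z p)\<^sup>2) \<le> degree (lagrange_basis I z p) * 2"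
    by (rule degree_power_le)
  then show ?thesis
    unfolding hermite_value_def
    using degree_lagrange_basis[OF assms, of z] degree_hermite_slope[OF assms, of z]
    by (intro degree_diff_less) auto
qed

context
  fixes I :: "'i set" and z :: "'i \<Rightarrow> 'a::field" and p s :: 'i
  assumes I: "finite I" "inj_on z I" "p \<in> I" "s \<in> I"
begin

lemma poly_hermite_slope_node: "poly (hermite_slope I z p) (z s) = 0"
  using poly_lagrange_basis_node[OF I] by (simp add: hermite_slope_def)

text \<open>At \<open>z p\<close> the linear factor kills one term of the product rule and the other
  is the squared value 1; at the other nodes the square has a double zero.\<close>

lemma poly_pderiv_hermite_slope_node:
  "poly (pderiv (hermite_slope I z p)) (z s) = (if s = p then 1 else 0)"
  using poly_lagrange_basis_node[OF I]
  by (simp add: hermite_slope_def pderiv_mult pderiv_pCons power2_eq_square del: mult_pCons_left)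

lemma poly_hermite_value_node: "poly (hermite_value I z p) (z s) = (if s = p then 1 else 0)"
  using poly_lagrange_basis_node[OF I] poly_hermite_slope_node
  by (simp add: hermite_value_def)

lemma poly_pderiv_hermite_value_node: "poly (pderiv (hermite_value I z p)) (z s) = 0"
  using poly_lagrange_basis_node[OF I] poly_pderiv_hermite_slope_node
  by (simp add: hermite_value_def pderiv_diff pderiv_smult pderiv_mult power2_eq_square)

end

lemma poly_eq_sum_lessThan:
  fixes P :: "'a::comm_semiring_1 poly"
  assumes "degree P < n"
  shows "poly P x = (\<Sum>k<n. coeff P k * x ^ k)"
proof -
  have "(\<Sum>k\<le>degree P. coeff P k * x ^ k) = (\<Sum>k<n. coeff P k * x ^ k)"
    using assms by (intro sum.mono_neutral_left) (auto simp: coeff_eq_0)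
  then show ?thesis
    by (simp add: poly_altdef)
qed

text \<open>The factor \<open>x\<close> undoes the index shift of the derivative, so the coefficient
  of \<open>x ^ k\<close> is merely weighted by \<open>k\<close>, as in the derivative columns of
  the matrix.\<close>

lemma poly_pderiv_eq_sum_lessThan:
  fixes P :: "'a::field_char_0 poly"
  assumes "degree P < n"
  shows "x * poly (pderiv P) x = (\<Sum>k<n. of_nat k * coeff P k * x ^ k)"
proof -
  have "degree (pCons 0 (pderiv P)) < n"
    using assms by (auto simp: degree_pCons_eq_if degree_pderiv pderiv_eq_0_iff)
  from poly_eq_sum_lessThan[OF this, of x]
  have "x * poly (pderiv P) x = (\<Sum>k<n. coeff (pCons 0 (pderiv P)) k * x ^ k)"
    by simp
  also have "\<dots> = (\<Sum>k<n. of_nat k * coeff P k * x ^ k)"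
    by (intro sum.cong) (auto simp: coeff_pCons coeff_pderiv split: nat.split)
  finally show ?thesis .
qed

section \<open>Interpolation by exponential polynomials\<close>

lemma exp_shift:
  "exp (\<i> * of_int (N + int k) * of_real x) = exp (\<i> * of_int N * of_real x) * exp (\<i> * of_real x) ^ k"
  by (simp add: exp_of_nat_mult[symmetric] exp_add[symmetric] algebra_simps)

lemma sum_coeff_exp:
  assumes "degree P < n"
  shows "(\<Sum>k<n. coeff P k * exp (\<i> * of_int (N + int k) * of_real x))
    = exp (\<i> * of_int N * of_real x) * poly P (exp (\<i> * of_real x))"
  unfolding poly_eq_sum_lessThan[OF assms] exp_shift sum_distrib_left
  by (simp add: mult_ac)

text \<open>The right side is the derivative in \<open>x\<close> of the right side of
  \<open>sum_coeff_exp\<close>, by the product and chain rules.\<close>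

lemma sum_coeff_deriv_exp:
  assumes "degree P < n"
  shows "(\<Sum>k<n. coeff P k
      * (\<i> * of_int (N + int k) * exp (\<i> * of_int (N + int k) * of_real x)))
    = \<i> * exp (\<i> * of_int N * of_real x)
      * (of_int N * poly P (exp (\<i> * of_real x))
         + exp (\<i> * of_real x) * poly (pderiv P) (exp (\<i> * of_real x)))"
  unfolding poly_eq_sum_lessThan[OF assms] poly_pderiv_eq_sum_lessThan[OF assms] exp_shift
    sum_distrib_left sum.distrib[symmetric]
  by (simp add: algebra_simps)

text \<open>Two points with the same image differ by a multiple of the period, and the half-open
  interval leaves only the multiple 0.\<close>

lemma inj_on_exp_i:
  assumes "A \<subseteq> {0..<2 * pi}"
  shows "inj_on (\<lambda>x::real. exp (\<i> * of_real x)) A"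
proof (rule inj_onI)
  fix x y assume xy: "x \<in> A" "y \<in> A" "exp (\<i> * of_real x) = exp (\<i> * of_real y)"
  then have "cis (x - y) = 1"
    by (simp add: cis_conv_exp right_diff_distrib exp_diff)
  then have "cos (x - y) = 1"
    by (simp add: complex_eq_iff)
  then obtain n :: int where n: "x - y = n * 2 * pi"
    by (auto simp: cos_one_2pi_int)
  moreover have "\<bar>x - y\<bar> < 2 * pi"
    using subsetD[OF assms xy(1)] subsetD[OF assms xy(2)] by auto
  ultimately have "\<bar>real_of_int n\<bar> * (2 * pi) < 1 * (2 * pi)"
    by (simp add: abs_mult)
  then have "n = 0"
    by (subst (asm) mult_less_cancel_right_pos) auto
  with n show "x = y"
    by simp
qed

text \<open>A left inverse of a square matrix over a field is two-sided. Hence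
  \<open>mat_inverse\<close> does not return \<open>None\<close>, and uniqueness of inverses
  identifies its result with the given coefficients.\<close>

lemma inv_entry_eqI:
  assumes "\<And>i j. i < 2 * m \<Longrightarrow> j < 2 * m \<Longrightarrow>
    (\<Sum>k<2 * m. c i k * node_entry N t (k + 1) (j + 1)) = (if i = j then 1 else 0)"
    and "i < 2 * m" "k < 2 * m"
  shows "inv_entry m N t (i + 1) (k + 1) = c i k"
proof -
  let ?H = "node_matrix m N t" and ?B = "mat (2 * m) (2 * m) (\<lambda>(i, k). c i k)"
  have H: "?H \<in> carrier_mat (2 * m) (2 * m)" and B: "?B \<in> carrier_mat (2 * m) (2 * m)"
    by (auto simp: node_matrix_def)
  have BH: "?B * ?H = 1\<^sub>m (2 * m)"
    using assms(1)
    by (intro eq_matI) (auto simp: node_matrix_def scalar_prod_def lessThan_atLeast0)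
  have HB: "?H * ?B = 1\<^sub>m (2 * m)"
    by (rule mat_mult_left_right_inverse[OF B H BH])
  have "?H \<in> Units (ring_mat TYPE(complex) (2 * m) ())"
    unfolding Units_def using H B BH HB by (auto simp: ring_mat_def)
  then obtain C where C: "mat_inverse ?H = Some C"
    using mat_inverse(1)[OF H, of "()"] by (cases "mat_inverse ?H") auto
  then have "?H * C = 1\<^sub>m (2 * m)" "C \<in> carrier_mat (2 * m) (2 * m)"
    using mat_inverse(2)[OF H] by auto
  \<comment> \<open>Evaluate \<open>?B * ?H * C\<close> with both bracketings.\<close>
  then have "C = ?B"
    using assoc_mult_mat[OF B H, of C] BH B by simp
  then show ?thesis
    using C assms(2,3) by (simp add: inv_entry_def)
qed

text \<open>\<open>phi_poly\<close> and \<open>psi_poly\<close> hold the rows \<open>2p\<close> and \<open>2p - 1\<close> of the inverse;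
  \<open>row_poly\<close> enumerates the rows from 0.\<close>

definition phi_poly :: "nat \<Rightarrow> int \<Rightarrow> (nat \<Rightarrow> real) \<Rightarrow> nat \<Rightarrow> complex poly" where
  "phi_poly m N t p = smult (- \<i> * exp (- (\<i> * of_int N * of_real (t p))) * exp (- (\<i> * of_real (t p))))
     (hermite_slope {1..m} (\<lambda>s. exp (\<i> * of_real (t s))) p)"

definition psi_poly :: "nat \<Rightarrow> int \<Rightarrow> (nat \<Rightarrow> real) \<Rightarrow> nat \<Rightarrow> complex poly" where
  "psi_poly m N t p = smult (exp (- (\<i> * of_int N * of_real (t p))))
     (hermite_value {1..m} (\<lambda>s. exp (\<i> * of_real (t s))) p) - smult (\<i> * of_int N) (phi_poly m N t p)"

definition row_poly :: "nat \<Rightarrow> int \<Rightarrow> (nat \<Rightarrow> real) \<Rightarrow> nat \<Rightarrow> complex poly" where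
  "row_poly m N t i =
     (if even i then psi_poly m N t (i div 2 + 1) else phi_poly m N t (i div 2 + 1))"

lemma degree_phi_poly:
  assumes "p \<in> {1..m}"
  shows "degree (phi_poly m N t p) < 2 * m"
  using degree_hermite_slope[of "{1..m}" p] assms by (simp add: phi_poly_def)

lemma degree_psi_poly:
  assumes "p \<in> {1..m}"
  shows "degree (psi_poly m N t p) < 2 * m"
  unfolding psi_poly_def
  using degree_hermite_value[of "{1..m}" p] degree_phi_poly[OF assms] assms
  by (intro degree_diff_less) auto

lemma degree_row_poly:
  assumes "i < 2 * m"
  shows "degree (row_poly m N t i) < 2 * m"
proof -
  have "i div 2 + 1 \<in> {1..m}"
    using assms by auto
  then show ?thesis
    by (simp add: row_poly_def degree_phi_poly degree_psi_poly)
qed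

section \<open>Duality between the row polynomials and the columns of the matrix\<close>

context
  fixes m :: nat and N :: int and t :: "nat \<Rightarrow> real"
  assumes inj: "inj_on (\<lambda>s. exp (\<i> * of_real (t s))) {1..m}"
begin

text \<open>The scalar in \<open>phi_poly\<close> inverts the factor that the chain rule produces at
  \<open>t p\<close>. Subtracting the multiple of \<open>phi_poly\<close> in \<open>psi_poly\<close>
  cancels the derivative of the exponential prefactor and leaves the values alone.\<close>

lemma row_poly_dual:
  assumes "i < 2 * m" "j < 2 * m"
  shows "(\<Sum>k<2 * m. coeff (row_poly m N t i) k * node_entry N t (k + 1) (j + 1))
    = (if i = j then 1 else 0)"
proof -
  let ?z = "\<lambda>s. exp (\<i> * of_real (t s))"
  define p s where "p = i div 2 + 1" and "s = j div 2 + 1"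
  have ps: "p \<in> {1..m}" "s \<in> {1..m}"
    using assms by (auto simp: p_def s_def)
  note I = finite_atLeastAtMost inj ps
  note nodes = poly_hermite_slope_node[OF I] poly_pderiv_hermite_slope_node[OF I]
    poly_hermite_value_node[OF I] poly_pderiv_hermite_value_node[OF I]
  \<comment> \<open>A 0-based index encodes a node and a parity: even columns hold values, odd ones
    derivatives.\<close>
  have ij: "i = j \<longleftrightarrow> p = s \<and> even i = even j"
    unfolding p_def s_def by presburger
  have row: "row_poly m N t i = (if even i then psi_poly m N t p else phi_poly m N t p)"
    by (simp add: row_poly_def p_def)
  show ?thesis
  proof (cases "even j")
    case True
    then have "node_entry N t (k + 1) (j + 1) = exp (\<i> * of_int (N + int k) * of_real (t s))" for k
      by (auto simp: node_entry_def s_def)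
    then have "(\<Sum>k<2 * m. coeff (row_poly m N t i) k * node_entry N t (k + 1) (j + 1))
      = exp (\<i> * of_int N * of_real (t s)) * poly (row_poly m N t i) (?z s)"
      using sum_coeff_exp[OF degree_row_poly[OF assms(1)]] by simp
    also have "\<dots> = (if i = j then 1 else 0)"
      using True ij nodes
      by (auto simp: row phi_poly_def psi_poly_def exp_minus simp del: One_nat_def)
    finally show ?thesis .
  next
    case False
    then have "node_entry N t (k + 1) (j + 1)
        = \<i> * of_int (N + int k) * exp (\<i> * of_int (N + int k) * of_real (t s))" for k
      by (auto simp: node_entry_def s_def elim!: oddE)
    then have "(\<Sum>k<2 * m. coeff (row_poly m N t i) k * node_entry N t (k + 1) (j + 1))
      = \<i> * exp (\<i> * of_int N * of_real (t s))
        * (of_int N * poly (row_poly m N t i) (?z s)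
           + ?z s * poly (pderiv (row_poly m N t i)) (?z s))"
      using sum_coeff_deriv_exp[OF degree_row_poly[OF assms(1)]] by simp
    also have "\<dots> = (if i = j then 1 else 0)"
      using False ij nodes
      by (auto simp: row phi_poly_def psi_poly_def exp_minus pderiv_smult pderiv_diff pderiv_minus field_simps
          simp del: One_nat_def)
    finally show ?thesis .
  qed
qed

lemma sum_inv_entry_exp:
  assumes "i < 2 * m"
  shows "(\<Sum>k = 1..2 * m. inv_entry m N t (i + 1) k * exp (\<i> * of_int (N + int k - 1) * of_real x))
    = exp (\<i> * of_int N * of_real x) * poly (row_poly m N t i) (exp (\<i> * of_real x))"
proof -
  have "(\<Sum>k = 1..2 * m. inv_entry m N t (i + 1) k * exp (\<i> * of_int (N + int k - 1) * of_real x))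
    = (\<Sum>k<2 * m. inv_entry m N t (i + 1) (k + 1) * exp (\<i> * of_int (N + int k) * of_real x))"
    by (rule sum.reindex_bij_witness[of _ Suc "\<lambda>k. k - 1"]) (auto simp: add_diff_eq)
  also have "\<dots> = (\<Sum>k<2 * m. coeff (row_poly m N t i) k * exp (\<i> * of_int (N + int k) * of_real x))"
    using inv_entry_eqI[OF row_poly_dual assms] by (intro sum.cong) auto
  also have "\<dots> = exp (\<i> * of_int N * of_real x) * poly (row_poly m N t i) (exp (\<i> * of_real x))"
    by (rule sum_coeff_exp[OF degree_row_poly[OF assms]])
  finally show ?thesis .
qed

lemma phi_eq_poly:
  assumes "p \<in> {1..m}"
  shows "phi m N t p x
    = exp (\<i> * of_int N * of_real x) * poly (phi_poly m N t p) (exp (\<i> * of_real x))"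
proof -
  \<comment> \<open>Since \<open>p\<close> is at least 1, the truncated subtraction is exact; the
    1-based row \<open>2 * p\<close> has the odd 0-based index \<open>2 * p - 1\<close>.\<close>
  have "2 * p - 1 < 2 * m" "2 * p - 1 + 1 = 2 * p" "(2 * p - 1) div 2 + 1 = p" "odd (2 * p - 1)"
    using assms by auto
  then show ?thesis
    using sum_inv_entry_exp[of "2 * p - 1" x] by (simp add: phi_def row_poly_def)
qed

lemma psi_eq_poly:
  assumes "p \<in> {1..m}"
  shows "psi m N t p x
    = exp (\<i> * of_int N * of_real x) * poly (psi_poly m N t p) (exp (\<i> * of_real x))"
proof -
  have "2 * p - 2 < 2 * m" "2 * p - 2 + 1 = 2 * p - 1" "(2 * p - 2) div 2 + 1 = p" "even (2 * p - 2)"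
    using assms by auto
  then show ?thesis
    using sum_inv_entry_exp[of "2 * p - 2" x] by (simp add: psi_def row_poly_def)
qed

end

section \<open>Closed forms of the interpolating functions\<close>

lemma sum_prod_delete_eq:
  fixes f :: "'i \<Rightarrow> 'a::field"
  assumes "finite A" "\<And>s. s \<in> A \<Longrightarrow> f s \<noteq> 0"
  shows "(\<Sum>s\<in>A. \<Prod>q\<in>A - {s}. f q) = (\<Prod>s\<in>A. f s) * (\<Sum>s\<in>A. inverse (f s))"
proof -
  have "(\<Prod>q\<in>A - {s}. f q) = (\<Prod>q\<in>A. f q) * inverse (f s)" if "s \<in> A" for s
    using prod.remove[OF assms(1) that, of f] assms(2)[OF that] by (simp add: field_simps)
  then show ?thesis
    by (simp add: sum_distrib_left)
qed

theorem mainTheorem2: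
  fixes m0 p :: nat and N1 :: int and t :: "nat \<Rightarrow> real" and x :: real
  assumes "m0 \<ge> 1"
    and "0 \<le> t 1" and "strict_mono_on {1..m0} t" and "t m0 < 2 * pi"
    and "p \<in> {1..m0}"
  shows "phi m0 N1 t p x =
      - \<i> * exp (\<i> * of_int N1 * of_real (x - t p)) * (exp (\<i> * of_real (x - t p)) - 1)
        * (\<Prod>s \<in> {1..m0} - {p}.
             (exp (\<i> * of_real x) - exp (\<i> * of_real (t s))) ^ 2
             * (exp (\<i> * of_real (t s)) - exp (\<i> * of_real (t p))) powi (- 2))
    \<and> psi m0 N1 t p x =
      2 * exp (\<i> * of_int N1 * of_real (x - t p))
        * (exp (\<i> * of_real x) - exp (\<i> * of_real (t p)))
        * (\<Prod>s \<in> {1..m0} - {p}.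
             (exp (\<i> * of_real x) - exp (\<i> * of_real (t s))) ^ 2
             * (exp (\<i> * of_real (t s)) - exp (\<i> * of_real (t p))) powi (- 3))
        * (\<Sum>s \<in> {1..m0} - {p}. \<Prod>q \<in> {1..m0} - {p, s}.
             (exp (\<i> * of_real (t q)) - exp (\<i> * of_real (t p))))
      - \<i> * of_int N1 * phi m0 N1 t p x
      + exp (\<i> * of_int N1 * of_real (x - t p))
        * (\<Prod>s \<in> {1..m0} - {p}.
             (exp (\<i> * of_real x) - exp (\<i> * of_real (t s))) ^ 2
             * (exp (\<i> * of_real (t s)) - exp (\<i> * of_real (t p))) powi (- 2))"
proof -
  let ?z = "\<lambda>s. exp (\<i> * of_real (t s))" and ?A = "{1..m0} - {p}" and ?y = "exp (\<i> * of_real x)"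
  let ?L = "lagrange_basis {1..m0} ?z p"
  let ?S = "\<Sum>s\<in>?A. inverse (?z s - ?z p)"
  note p = assms(5)
  have "t ` {1..m0} \<subseteq> {0..<2 * pi}"
  proof
    fix u assume "u \<in> t ` {1..m0}"
    then obtain s where s: "s \<in> {1..m0}" "u = t s"
      by auto
    have "t 1 \<le> t s" "t s \<le> t m0"
      using s assms(1) strict_mono_onD[OF assms(3), of 1 s] strict_mono_onD[OF assms(3), of s m0]
      by (auto simp: le_less)
    then show "u \<in> {0..<2 * pi}"
      using s assms(2,4) by auto
  qed
  then have inj: "inj_on ?z {1..m0}"
    using comp_inj_on[OF strict_mono_on_imp_inj_on[OF assms(3)] inj_on_exp_i] by (simp add: comp_def)
  have nz: "?z s - ?z p \<noteq> 0" if "s \<in> ?A" for s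
    using that p inj_onD[OF inj, of s p] by auto
  have Ex: "exp (\<i> * of_int N1 * of_real (x - t p))
      = exp (\<i> * of_int N1 * of_real x) * exp (- (\<i> * of_int N1 * of_real (t p)))"
    by (simp add: exp_add[symmetric] algebra_simps)
  \<comment> \<open>The Lagrange denominators are \<open>?z p - ?z s\<close>; squaring absorbs the
    opposite sign.\<close>
  have L2: "(poly ?L ?y)\<^sup>2 = (\<Prod>s\<in>?A. (?y - ?z s) ^ 2 * (?z s - ?z p) powi (- 2))"
    unfolding poly_lagrange_basis prod_power_distrib
    by (intro prod.cong refl)
      (simp add: power_int_minus power_mult_distrib power_inverse divide_inverse power2_commute[of "?z p"])
  have slope: "exp (- (\<i> * of_real (t p))) * poly (hermite_slope {1..m0} ?z p) ?y
      = (exp (\<i> * of_real (x - t p)) - 1) * (poly ?L ?y)\<^sup>2"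
    by (simp add: hermite_slope_def exp_diff exp_minus field_simps)
  have phi: "phi m0 N1 t p x = - \<i> * exp (\<i> * of_int N1 * of_real (x - t p))
      * (exp (\<i> * of_real (x - t p)) - 1) * (poly ?L ?y)\<^sup>2"
    unfolding phi_eq_poly[OF inj p] phi_poly_def Ex poly_smult
    using slope by (simp add: mult_ac)
  \<comment> \<open>Here the sign remains: it turns the subtracted correction in
    \<open>hermite_value\<close> into the positive first summand of \<open>psi\<close>.\<close>
  have "?S = - poly (pderiv ?L) (?z p)"
    unfolding poly_pderiv_lagrange_basis[OF finite_atLeastAtMost inj p] sum_negf[symmetric]
    by (intro sum.cong) (auto simp: inverse_minus_eq[symmetric] simp del: inverse_minus_eq)
  then have psi: "psi m0 N1 t p x
      = 2 * exp (\<i> * of_int N1 * of_real (x - t p)) * (?y - ?z p) * ((poly ?L ?y)\<^sup>2 * ?S)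
        - \<i> * of_int N1 * phi m0 N1 t p x
        + exp (\<i> * of_int N1 * of_real (x - t p)) * (poly ?L ?y)\<^sup>2"
    unfolding psi_eq_poly[OF inj p] phi_eq_poly[OF inj p] psi_poly_def Ex hermite_value_def
    by (simp add: hermite_slope_def algebra_simps)
  \<comment> \<open>The exponent -3 carries one surplus inverse per node. It cancels the full
    product that appears when the sum of products with one factor deleted is written as that product
    times \<open>?S\<close>.\<close>
  have "(\<Prod>s\<in>?A. (?y - ?z s) ^ 2 * (?z s - ?z p) powi (- 3)) * (\<Prod>s\<in>?A. ?z s - ?z p)
      = (poly ?L ?y)\<^sup>2"
    unfolding L2 prod.distrib[symmetric]
    using nz power_int_add_1[of "?z s - ?z p" "- 3" for s]
    by (intro prod.cong) (auto simp: mult.assoc)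
  moreover have "(\<Sum>s\<in>?A. \<Prod>q\<in>{1..m0} - {p, s}. (?z q - ?z p)) = (\<Prod>s\<in>?A. ?z s - ?z p) * ?S"
    unfolding Diff_insert2[of _ p "{_}"] using nz by (intro sum_prod_delete_eq) auto
  ultimately have "(poly ?L ?y)\<^sup>2 * ?S
      = (\<Prod>s\<in>?A. (?y - ?z s) ^ 2 * (?z s - ?z p) powi (- 3))
        * (\<Sum>s\<in>?A. \<Prod>q\<in>{1..m0} - {p, s}. (?z q - ?z p))"
    by (simp add: mult.assoc[symmetric])
  with phi psi show ?thesis
    unfolding L2 by (simp only: mult.assoc)
qed

end
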